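(* Let $A \in \{0,\star\}^{d\times d}$ and $B\in\{0,\star\}^{d\times m}$ be such that $(A,B)$ is structurally controllable, let each nonzero entry $B_{ij}$ carry a cost $w_{ij}\ge 0$, and suppose that the bipartite graph $\Gamma(A)$ has a perfect matching. Then the matrix $B^{*}$ produced by the SSCC-selection algorithm (described in the context) is such that $(A,B^{*})$ is structurally controllable, and $B^{*}$ solves the problem $$\min_{B'\in\mathcal{K}} \|B'\|_w \quad\text{subject to}\quad \|B'\|_0\le \|B''\|_0 \ \text{ for all } B''\in\mathcal{K};$$ that is, $B^{*}$ has minimum cost $\|\cdot\|_w$ among all elements of $\mathcal{K}$ having the minimum number of nonzero entries.
   Context: A matrix with entries in $\{0,\star\}$ is a sparsity matrix: each entry is either a fixed zero or an independent free parameter $\star$. A numerical realization is obtained by assigning real values to the $\star$ entries (zeros stay zero). The pair $(A,B)$ with $A\in\{0,\star\}^{d\times d}$, $B\in\{0,\star\}^{d\times m}$ is structurally controllable if there is at least one numerical realization $(A',B')$ of $(A,B)$ such that the linear system $\dot x = A'x+B'u$ is controllable. $Z(B)=\{(i,j) : B_{ij}=0\}$, and $\mathcal{K}$ is the set of all $B'\in\{0,\star\}^{d\times m}$ with $Z(B)\subset Z(B')$ and $(A,B')$ structurally controllable. $\|B'\|_0$ is the number of nonzero ($\star$) entries of $B'$, and $\|B'\|_w=\sum_{(i,j): B'_{ij}\ne0} w_{ij}$. $G(A)$ is the digraph with vertex set $\{v_1,\dots,v_d\}$ and a directed edge $(v_j,v_i)$ whenever $A_{ij}\neq 0$. A strongly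 connected component (SCC) is a maximal strongly connected subgraph of $G(A)$; it is a source strongly connected component (SSCC) if there is no directed edge from a vertex of another SCC into any of its vertices. $\Gamma(A)$ is the undirected bipartite graph with parts $V_A^1=\{v_1^1,\dots,v_d^1\}$ and $V_A^2=\{v_1^2,\dots,v_d^2\}$ and edges $(v_j^1,v_i^2)$ whenever $A_{ij}\neq0$. A matching is perfect if it saturates all vertices. SSCC-selection algorithm. Set $w_{ij}=\infty$ whenever $B_{ij}=0$ (for practical purposes, $w_{ij}=w_{\max}+1$, where $w_{\max}$ is the largest cost of a nonzero entry of $B$). Determine the SSCCs $\mathcal{S}_1,\dots,\mathcal{S}_q$ of $G(A)$ and set $L=\emptyset$. For each $\mathcal{S}_j$: for each state vertex $v_i\in\mathcal{S}_j$ choose the smallest cost $w_{ik}$ among $w_{i1},\dots,w_{im}$; then among all $v_i\in\mathcal{S}_j$ choose a vertex $v_\ell$ whose chosen cost $w_{\ell k}$ is least (ties broken arbitrarily), and add $(u_k,v_\ell)$ to $L$. Output $B^{*}\in\{0,\star\}^{d\times m}$ with $B^{*}_{\ell k}=\star$ if $(u_k,v_\ell)\in L$ and $B^{*}_{\ell k}=0$ otherwise. *)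

theory Defs
  imports "HOL-Analysis.Analysis" "Graph_Theory.Digraph_Component"
begin

section \<open>Sparsity matrices and structural controllability\<close>

datatype entry = Zero | Star

text \<open>Dimensions are index types: a \<open>d \<times> m\<close> matrix has type \<open>_ ^ 'm ^ 'd\<close>, and \<open>A $ i $ j\<close> is its
  entry in row \<open>i\<close> and column \<open>j\<close>.\<close>

definition realization :: "entry ^ 'n ^ 'd \<Rightarrow> real ^ 'n ^ 'd \<Rightarrow> bool" where
  "realization M M' \<longleftrightarrow> (\<forall>i j. M $ i $ j = Zero \<longrightarrow> M' $ i $ j = 0)"

text \<open>Controllability of \<open>x' = A x + B u\<close>: every state can be steered to every state in finite time
  by some continuous input, \<open>x\<close> being a classical solution on \<open>[0, T]\<close>.\<close>

definition controllable :: "real ^ 'd ^ 'd \<Rightarrow> real ^ 'm ^ 'd \<Rightarrow> bool" where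
  "controllable A B \<longleftrightarrow>
    (\<forall>x0 x1 :: real ^ 'd. \<exists>T > 0. \<exists>(u :: real \<Rightarrow> real ^ 'm) (x :: real \<Rightarrow> real ^ 'd).
        continuous_on {0..T} u \<and> x 0 = x0 \<and> x T = x1 \<and>
        (\<forall>t\<in>{0..T}. (x has_vector_derivative (A *v x t + B *v u t)) (at t within {0..T})))"

definition structurally_controllable :: "entry ^ 'd ^ 'd \<Rightarrow> entry ^ 'm ^ 'd \<Rightarrow> bool" where
  "structurally_controllable A B \<longleftrightarrow>
    (\<exists>A' B'. realization A A' \<and> realization B B' \<and> controllable A' B')"

definition zero_set :: "entry ^ 'm ^ 'd \<Rightarrow> ('d \<times> 'm) set" where
  "zero_set B = {(i, j). B $ i $ j = Zero}"

definition K_set :: "entry ^ 'd ^ 'd \<Rightarrow> entry ^ 'm ^ 'd \<Rightarrow> (entry ^ 'm ^ 'd) set" where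
  "K_set A B = {B'. zero_set B \<subseteq> zero_set B' \<and> structurally_controllable A B'}"

definition norm0 :: "entry ^ 'm ^ 'd \<Rightarrow> nat" where
  "norm0 B' = card {(i, j). B' $ i $ j \<noteq> Zero}"

definition norm_w :: "real ^ 'm ^ 'd \<Rightarrow> entry ^ 'm ^ 'd \<Rightarrow> real" where
  "norm_w w B' = (\<Sum>(i, j) \<in> {(i, j). B' $ i $ j \<noteq> Zero}. w $ i $ j)"

section \<open>The graphs of a sparsity matrix\<close>

text \<open>Column \<open>j\<close>, row \<open>i\<close> gives the arc from \<open>j\<close> to \<open>i\<close>.\<close>

definition state_digraph :: "entry ^ 'd ^ 'd \<Rightarrow> ('d, 'd \<times> 'd) pre_digraph" where
  "state_digraph A =
    \<lparr>verts = UNIV, arcs = {(j, i). A $ i $ j \<noteq> Zero}, tail = fst, head = snd\<rparr>"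

definition is_sscc :: "('v, 'e) pre_digraph \<Rightarrow> ('v, 'e) pre_digraph \<Rightarrow> bool" where
  "is_sscc G S \<longleftrightarrow> S \<in> pre_digraph.sccs G \<and>
    \<not> (\<exists>S' \<in> pre_digraph.sccs G. S' \<noteq> S \<and>
        (\<exists>e \<in> arcs G. tail G e \<in> verts S' \<and> head G e \<in> verts S))"

text \<open>The bipartite graph on \<open>'d + 'd\<close>: \<open>Inl j\<close> is \<open>v\<^sub>j\<^sup>1\<close> and \<open>Inr i\<close> is \<open>v\<^sub>i\<^sup>2\<close>.\<close>

definition bipartite_edges :: "entry ^ 'd ^ 'd \<Rightarrow> ('d + 'd) set set" where
  "bipartite_edges A = {{Inl j, Inr i} | i j. A $ i $ j \<noteq> Zero}"

definition matching :: "'v set set \<Rightarrow> 'v set set \<Rightarrow> bool" where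
  "matching E M \<longleftrightarrow> M \<subseteq> E \<and> pairwise disjnt M"

definition perfect_matching :: "'v set \<Rightarrow> 'v set set \<Rightarrow> 'v set set \<Rightarrow> bool" where
  "perfect_matching V E M \<longleftrightarrow> matching E M \<and> V \<subseteq> \<Union>M"

section \<open>The SSCC-selection algorithm\<close>

definition ext_cost :: "entry ^ 'm ^ 'd \<Rightarrow> real ^ 'm ^ 'd \<Rightarrow> 'd \<Rightarrow> 'm \<Rightarrow> ereal" where
  "ext_cost B w i j = (if B $ i $ j = Zero then \<infinity> else ereal (w $ i $ j))"

text \<open>One pass of the loop over the SSCCs, as a relation because ties are broken arbitrarily:
  \<open>k i\<close> is the column chosen for the state vertex \<open>i\<close>, and \<open>l\<close> is the vertex chosen in \<open>S\<close>.\<close>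

definition selects :: "('d \<Rightarrow> 'm \<Rightarrow> ereal) \<Rightarrow> 'd set \<Rightarrow> 'm \<times> 'd \<Rightarrow> bool" where
  "selects c S e \<longleftrightarrow>
    (\<exists>k l. (\<forall>i\<in>S. is_arg_min (c i) (\<lambda>_. True) (k i)) \<and>
           is_arg_min (\<lambda>i. c i (k i)) (\<lambda>i. i \<in> S) l \<and> e = (k l, l))"

text \<open>\<open>Bs\<close> is a possible output; \<open>sel\<close> records the edge added to \<open>L\<close> for each SSCC.\<close>

definition sscc_selection_output ::
    "entry ^ 'd ^ 'd \<Rightarrow> entry ^ 'm ^ 'd \<Rightarrow> real ^ 'm ^ 'd \<Rightarrow> entry ^ 'm ^ 'd \<Rightarrow> bool" where
  "sscc_selection_output A B w Bs \<longleftrightarrow>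
    (\<exists>sel. (\<forall>S. is_sscc (state_digraph A) S \<longrightarrow> selects (ext_cost B w) (verts S) (sel S)) \<and>
       (let L = sel ` {S. is_sscc (state_digraph A) S}
        in Bs = (\<chi> l k. if (k, l) \<in> L then Star else Zero)))"

lemma ex_is_arg_min_finite_type:
  fixes f :: "'x::finite \<Rightarrow> ereal"
  assumes "X \<noteq> {}"
  shows "\<exists>x. is_arg_min f (\<lambda>x. x \<in> X) x"
  using ex_is_arg_min_if_finite[of X f] assms by auto

lemma sscc_selection_output_exists:
  fixes A :: "entry ^ 'd ^ 'd" and B :: "entry ^ 'm ^ 'd"
  shows "\<exists>Bs. sscc_selection_output A B w Bs"
proof -
  have "\<exists>e. selects (ext_cost B w) (verts S) e" if "is_sscc (state_digraph A) S" for S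
  proof -
    have ne: "verts S \<noteq> {}"
      using that by (auto simp: is_sscc_def pre_digraph.sccs_def strongly_connected_def)
    have "\<forall>i. \<exists>j. is_arg_min (ext_cost B w i) (\<lambda>_. True) j"
      using ex_is_arg_min_finite_type[of "UNIV :: 'm set"] by simp
    then obtain k where "\<forall>i. is_arg_min (ext_cost B w i) (\<lambda>_. True) (k i)"
      by metis
    moreover obtain l where "is_arg_min (\<lambda>i. ext_cost B w i (k i)) (\<lambda>i. i \<in> verts S) l"
      using ex_is_arg_min_finite_type[OF ne] by blast
    ultimately show ?thesis
      unfolding selects_def by blast
  qed
  then obtain sel where
    "\<forall>S. is_sscc (state_digraph A) S \<longrightarrow> selects (ext_cost B w) (verts S) (sel S)"
    by metis
  then show ?thesis
    unfolding sscc_selection_output_def Let_def by blast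
qed

end

theory Submission
  imports Defs "HOL-Computational_Algebra.Fundamental_Theorem_Algebra"
begin

text \<open>With a perfect matching in \<open>\<Gamma>(A)\<close>, the pair \<open>(A, B')\<close> is structurally controllable iff every
  source component contains a vertex with an input. Necessity: without an input, the states of a
  source component form an autonomous linear system, so they stay at \<open>0\<close> if they start there.
  Sufficiency: a perfect matching is a permutation \<open>p\<close> along whose cycles \<open>A\<close> is nonzero. Keep only
  these cycles, with a different weight on each, and the arcs of a spanning forest of the cycles
  rooted at inputs. A left eigenvector of this realization has an eigenvalue whose modulus is
  the weight of the topmost cycle in its support, so its support is the path of cycles from there
  down to one root; none of its entries vanish on that path, and so it does not annihilate the
  input matrix. The Hautus test then gives controllability.

  Hence the minimum number of nonzero entries is the number of source components, it is attained
  by choosing one entry for each of them, and the cheapest such choice is made componentwise.\<close>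

section \<open>Krylov relations\<close>

lemma span_image_lessThan_sum:
  fixes f :: "nat \<Rightarrow> 'a::real_vector"
  assumes "x \<in> span (f ` {..<n})"
  shows "\<exists>a. x = (\<Sum>k<n. a k *\<^sub>R f k)"
  using assms
proof (induction n arbitrary: x)
  case 0
  then show ?case by simp
next
  case (Suc n)
  then obtain c where "x - c *\<^sub>R f n \<in> span (f ` {..<n})"
    by (auto simp: lessThan_Suc span_breakdown_eq)
  then obtain a where "x - c *\<^sub>R f n = (\<Sum>k<n. a k *\<^sub>R f k)"
    using Suc.IH by blast
  then have "x = (\<Sum>k<Suc n. (a(n := c)) k *\<^sub>R f k)"
    by (simp add: algebra_simps)
  then show ?case by blast
qed

text \<open>Otherwise every \<open>f n\<close> lies outside the span of its predecessors, and the
  first \<open>n\<close> vectors span dimension \<open>n\<close> for all \<open>n\<close>.\<close>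

lemma krylov_relation:
  fixes f :: "nat \<Rightarrow> 'a::euclidean_space"
  shows "\<exists>n a. f n = (\<Sum>k<n. a k *\<^sub>R f k)"
proof (rule ccontr)
  assume no_relation: "\<not> ?thesis"
  have "dim (f ` {..<n}) = n" for n
  proof (induction n)
    case (Suc n)
    have "f n \<notin> span (f ` {..<n})"
      using no_relation span_image_lessThan_sum by blast
    then show ?case
      using Suc by (simp add: lessThan_Suc dim_insert)
  qed simp
  then have "dim (f ` {..<Suc DIM('a)}) = Suc DIM('a)" by blast
  then show False
    using dim_subset_UNIV[of "f ` {..<Suc DIM('a)}"] by simp
qed

section \<open>From the Kalman rank condition to controllability\<close>

text \<open>The horizon is fixed at 1, and endpoints are collected as pairs so that superposition of
  trajectories makes this a subspace of the product space.\<close>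

definition steerable :: "real ^ 'd ^ 'd \<Rightarrow> real ^ 'm ^ 'd \<Rightarrow> ((real ^ 'd) \<times> (real ^ 'd)) set" where
  "steerable A B = {(x0, x1). \<exists>(u :: real \<Rightarrow> real ^ 'm) (x :: real \<Rightarrow> real ^ 'd).
        continuous_on {0..1} u \<and> x 0 = x0 \<and> x 1 = x1 \<and>
        (\<forall>t\<in>{0..1}. (x has_vector_derivative (A *v x t + B *v u t)) (at t within {0..1}))}"

lemma controllable_if_steerable_UNIV:
  assumes "steerable A B = UNIV"
  shows "controllable A B"
  unfolding controllable_def
proof (intro allI exI[of _ "1::real"] conjI)
  fix x0 x1
  have "(x0, x1) \<in> steerable A B" using assms by simp
  then show "\<exists>u x. continuous_on {0..1} u \<and> x 0 = x0 \<and> x 1 = x1 \<and>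
      (\<forall>t\<in>{0..1}. (x has_vector_derivative A *v x t + B *v u t) (at t within {0..1}))"
    unfolding steerable_def by simp
qed simp

lemma subspace_steerable: "subspace (steerable A B)"
proof (rule subspaceI)
  show "0 \<in> steerable A B"
    unfolding steerable_def zero_prod_def
    by (auto intro!: exI[of _ "\<lambda>_. 0"])
next
  fix p q assume "p \<in> steerable A B" "q \<in> steerable A B"
  then obtain u x v y where
    "continuous_on {0..1} u" "continuous_on {0..1} v"
    "p = (x 0, x 1)" "q = (y 0, y 1)"
    "\<forall>t\<in>{0..1}. (x has_vector_derivative (A *v x t + B *v u t)) (at t within {0..1})"
    "\<forall>t\<in>{0..1}. (y has_vector_derivative (A *v y t + B *v v t)) (at t within {0..1})"
    unfolding steerable_def by auto
  moreover from this have "\<forall>t\<in>{0..1}. ((\<lambda>t. x t + y t) has_vector_derivative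
      (A *v (x t + y t) + B *v (u t + v t))) (at t within {0..1})"
    by (auto simp: matrix_vector_right_distrib algebra_simps
        dest: bspec intro!: has_vector_derivative_eq_rhs[OF has_vector_derivative_add])
  ultimately show "p + q \<in> steerable A B"
    unfolding steerable_def
    by (auto intro!: exI[of _ "\<lambda>t. u t + v t"] exI[of _ "\<lambda>t. x t + y t"] continuous_intros)
next
  fix c p assume "p \<in> steerable A B"
  then obtain u x where
    "continuous_on {0..1} u" "p = (x 0, x 1)"
    "\<forall>t\<in>{0..1}. (x has_vector_derivative (A *v x t + B *v u t)) (at t within {0..1})"
    unfolding steerable_def by auto
  moreover from this have "\<forall>t\<in>{0..1}. ((\<lambda>t. c *\<^sub>R x t) has_vector_derivative
      (A *v (c *\<^sub>R x t) + B *v (c *\<^sub>R u t))) (at t within {0..1})"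
    by (auto simp: matrix_vector_mult_scaleR scaleR_right_distrib
        intro!: has_vector_derivative_eq_rhs[OF has_vector_derivative_scaleR])
  ultimately show "c *\<^sub>R p \<in> steerable A B"
    unfolding steerable_def
    by (auto intro!: exI[of _ "\<lambda>t. c *\<^sub>R u t"] exI[of _ "\<lambda>t. c *\<^sub>R x t"] continuous_intros)
qed

text \<open>If \<open>A\<^sup>n b = (\<Sum>k<n. a k *\<^sub>R A\<^sup>k b)\<close>, then the coordinate \<open>y\<close> of a trajectory along \<open>A\<^bsup>n-1\<^esup> b\<close>
  can be chosen freely and determines the others: with reversed coefficients \<open>a (n - 1 - i)\<close>,
  \<open>flat_coeff\<close> gives at \<open>i < n\<close> the coordinate along \<open>A\<^bsup>n-1-i\<^esup> b\<close> and at \<open>n\<close> the input.\<close>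

primrec flat_coeff :: "(nat \<Rightarrow> real) \<Rightarrow> real poly \<Rightarrow> nat \<Rightarrow> real poly" where
  "flat_coeff a y 0 = y"
| "flat_coeff a y (Suc i) = pderiv (flat_coeff a y i) - smult (a i) y"

text \<open>Each recursion step differentiates and so lowers the order of the zero at
  \<open>c\<close> by exactly one; the subtracted multiple of \<open>y\<close> still vanishes there
  to order at least \<open>m\<close>, too high to disturb the cofactor at \<open>c\<close>.\<close>

lemma flat_coeff_at_zero:
  assumes "i \<le> m" "poly g c \<noteq> 0"
  shows "\<exists>h. flat_coeff a ([:-c, 1:] ^ m * g) i = [:-c, 1:] ^ (m - i) * h \<and> poly h c \<noteq> 0"
  using assms(1)
proof (induction i)
  case 0
  then show ?case using assms(2) by auto
next
  case (Suc i)
  then obtain h where h: "flat_coeff a ([:-c, 1:] ^ m * g) i = [:-c, 1:] ^ (m - i) * h"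
    "poly h c \<noteq> 0" by auto
  define k where "k = m - Suc i"
  have mi: "m - i = Suc k" "m = k + Suc i" using Suc.prems by (auto simp: k_def)
  define h' where "h' = smult (of_nat (Suc k)) h + [:-c, 1:] * pderiv h
      - smult (a i) ([:-c, 1:] ^ Suc i * g)"
  \<comment> \<open>Only the derivative 1 of the linear factor matters, so it is replaced by an
    opaque \<open>q\<close>.\<close>
  have factor: "pderiv (q ^ Suc k * h) - smult (a i) (q ^ (k + Suc i) * g) =
      q ^ k * (smult (of_nat (Suc k)) h + q * pderiv h - smult (a i) (q ^ Suc i * g))"
    if "pderiv q = 1" for q
    by (simp only: that pderiv_mult pderiv_power_Suc) (simp add: power_add algebra_simps)
  have "flat_coeff a ([:-c, 1:] ^ m * g) (Suc i) = [:-c, 1:] ^ k * h'"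
    unfolding flat_coeff.simps h(1) mi(1) h'_def unfolding mi(2)
    by (rule factor) (simp add: pderiv_pCons)
  moreover have "poly h' c \<noteq> 0"
    using h(2) by (simp add: h'_def)
  ultimately show ?case unfolding k_def by blast
qed

text \<open>Differentiation turns \<open>z i\<close> into \<open>z (Suc i)\<close> plus a multiple
  of \<open>y\<close>. By the relation these multiples add up to \<open>y\<close> times
  \<open>T n\<close>, the term of \<open>A x\<close> with \<open>i = 0\<close>; the left-over
  \<open>z n\<close> at \<open>T 0\<close> is the input, applied along \<open>e\<close>.\<close>

lemma flat_trajectory:
  fixes A :: "real ^ 'd ^ 'd" and B :: "real ^ 'm ^ 'd" and e :: "real ^ 'm" and n :: nat and y :: "real poly" and a :: "nat \<Rightarrow> real"
  defines "T \<equiv> \<lambda>k. (((*v) A) ^^ k) (B *v e)"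
  assumes rel: "T n = (\<Sum>k<n. a k *\<^sub>R T k)"
  defines "z \<equiv> flat_coeff (\<lambda>i. a (n - Suc i)) y"
  defines "x \<equiv> \<lambda>t. \<Sum>i<n. poly (z i) t *\<^sub>R T (n - Suc i)"
  shows "(x 0, x 1) \<in> steerable A B"
proof -
  have T_Suc: "A *v T k = T (Suc k)" for k
    by (simp add: T_def)
  have relz: "(\<Sum>i<n. a (n - Suc i) *\<^sub>R T (n - Suc i)) = T n"
    unfolding rel using sum.nat_diff_reindex[of "\<lambda>k. a k *\<^sub>R T k" n] by simp
  have "(x has_vector_derivative (A *v x t + B *v (poly (z n) t *\<^sub>R e))) (at t within {0..1})" for t
  proof -
    have "(x has_vector_derivative (\<Sum>i<n. poly (pderiv (z i)) t *\<^sub>R T (n - Suc i))) (at t within {0..1})"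
      unfolding x_def
      by (intro has_vector_derivative_sum has_vector_derivative_eq_rhs[OF has_vector_derivative_scaleR])
        (auto intro: DERIV_subset poly_DERIV)
    also have "(\<Sum>i<n. poly (pderiv (z i)) t *\<^sub>R T (n - Suc i)) =
        (\<Sum>i<n. poly (z (Suc i)) t *\<^sub>R T (n - Suc i)) + poly y t *\<^sub>R (\<Sum>i<n. a (n - Suc i) *\<^sub>R T (n - Suc i))"
      unfolding z_def by (simp add: sum.distrib[symmetric] scaleR_sum_right algebra_simps)
    also have "\<dots> = (\<Sum>i<n. poly (z (Suc i)) t *\<^sub>R T (n - Suc i)) + poly (z 0) t *\<^sub>R T n"
      unfolding relz by (simp add: z_def)
    also have "\<dots> = (\<Sum>i<Suc n. poly (z i) t *\<^sub>R T (n - i))"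
      by (subst sum.lessThan_Suc_shift) simp
    also have "\<dots> = (\<Sum>i<n. poly (z i) t *\<^sub>R T (n - i)) + poly (z n) t *\<^sub>R (B *v e)"
      by (simp add: T_def)
    also have "(\<Sum>i<n. poly (z i) t *\<^sub>R T (n - i)) = A *v x t"
      unfolding x_def
      by (simp add: linear_sum[OF matrix_vector_mul_linear] matrix_vector_mult_scaleR T_Suc Suc_diff_Suc)
    finally show ?thesis by (simp add: matrix_vector_mult_scaleR)
  qed
  moreover have "continuous_on {0..1} (\<lambda>t. poly (z n) t *\<^sub>R e)"
    by (intro continuous_intros)
  ultimately show ?thesis
    unfolding steerable_def by blast
qed

text \<open>Here \<open>c\<close> is the end time at which the state is the Krylov vector and \<open>c'\<close> the one at which it is
  \<open>0\<close>. For \<open>y = (t - c)\<^sup>m (t - c')\<^sup>n\<close> all coordinates vanish at \<open>c'\<close>, and at \<open>c\<close> only those along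
  \<open>A\<^sup>k b\<close> with \<open>k < n - m\<close> can be nonzero, the topmost one being so.\<close>

lemma krylov_end_steerable:
  fixes A :: "real ^ 'd ^ 'd" and B :: "real ^ 'm ^ 'd" and e :: "real ^ 'm"
    and c c' :: real
  assumes endpoints: "(J = (\<lambda>v. (v, 0)) \<and> c = 0 \<and> c' = 1) \<or> (J = (\<lambda>v. (0, v)) \<and> c = 1 \<and> c' = 0)"
  shows "J ((((*v) A) ^^ k) (B *v e)) \<in> steerable A B"
proof -
  define T where "T = (\<lambda>k. (((*v) A) ^^ k) (B *v e))"
  have "linear J"
    using endpoints by (auto intro!: linearI)
  then have "subspace (J -` steerable A B)"
    using subspace_steerable by (rule linear_subspace_vimage)
  note sub = subspace_scale[OF this] subspace_sum[OF this] subspace_diff[OF this]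
  obtain n a where rel: "T n = (\<Sum>k<n. a k *\<^sub>R T k)"
    using krylov_relation[of T] by blast
  \<comment> \<open>The coefficients are numbered downwards, \<open>z m\<close> belonging to
    \<open>T k\<close>. At \<open>c\<close> the state is a nonzero multiple of \<open>T k\<close>
    plus Krylov vectors of smaller index, which the induction hypothesis removes.\<close>
  have low: "J (T k) \<in> steerable A B" if "k < n" for k
    using that
  proof (induction k rule: less_induct)
    case (less k)
    define m where "m = n - Suc k"
    have m: "m < n" "n - Suc m = k" using less.prems by (auto simp: m_def)
    let ?y = "[:-c, 1:] ^ m * [:-c', 1:] ^ n"
    define z where "z = flat_coeff (\<lambda>i. a (n - Suc i)) ?y"
    define x where "x = (\<lambda>t. \<Sum>i<n. poly (z i) t *\<^sub>R T (n - Suc i))"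
    have "(x 0, x 1) \<in> steerable A B"
      unfolding x_def z_def T_def
      by (rule flat_trajectory) (use rel in \<open>simp add: T_def\<close>)
    moreover have "x c' = 0"
    proof -
      have "poly (z i) c' = 0" if "i < n" for i
      proof -
        have "poly ([:-c, 1:] ^ m) c' \<noteq> 0" using endpoints by auto
        then obtain h where "z i = [:-c', 1:] ^ (n - i) * h"
          using flat_coeff_at_zero[of i n "[:-c, 1:] ^ m" c'] \<open>i < n\<close>
          unfolding z_def by (auto simp: mult.commute)
        then show ?thesis using \<open>i < n\<close> by simp
      qed
      then show ?thesis by (simp add: x_def)
    qed
    ultimately have "J (x c) \<in> steerable A B"
      using endpoints by auto
    moreover have "x c = poly (z m) c *\<^sub>R T k + (\<Sum>i\<in>{m<..<n}. poly (z i) c *\<^sub>R T (n - Suc i))"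
    proof -
      have "poly (z i) c = 0" if "i < m" for i
      proof -
        have "poly ([:-c', 1:] ^ n) c \<noteq> 0" using endpoints by auto
        then obtain h where "z i = [:-c, 1:] ^ (m - i) * h"
          using flat_coeff_at_zero[of i m "[:-c', 1:] ^ n" c] \<open>i < m\<close>
          unfolding z_def by auto
        then show ?thesis using \<open>i < m\<close> by simp
      qed
      moreover have "x c = (\<Sum>i\<in>{..<m} \<union> insert m {m<..<n}. poly (z i) c *\<^sub>R T (n - Suc i))"
        unfolding x_def by (rule sum.cong) (use m in auto)
      moreover have "\<dots> = (\<Sum>i<m. poly (z i) c *\<^sub>R T (n - Suc i)) +
          (\<Sum>i\<in>insert m {m<..<n}. poly (z i) c *\<^sub>R T (n - Suc i))"
        by (rule sum.union_disjoint) auto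
      ultimately show ?thesis by (simp add: m)
    qed
    moreover have "J (\<Sum>i\<in>{m<..<n}. poly (z i) c *\<^sub>R T (n - Suc i)) \<in> steerable A B"
    proof -
      have "T (n - Suc i) \<in> J -` steerable A B" if "i \<in> {m<..<n}" for i
        using less.IH[of "n - Suc i"] that m by auto
      then have "(\<Sum>i\<in>{m<..<n}. poly (z i) c *\<^sub>R T (n - Suc i)) \<in> J -` steerable A B"
        by (intro sub(1,2))
      then show ?thesis by simp
    qed
    ultimately have "J (poly (z m) c *\<^sub>R T k) \<in> steerable A B"
      using sub(3)[of "x c" "\<Sum>i\<in>{m<..<n}. poly (z i) c *\<^sub>R T (n - Suc i)"] by simp
    moreover have "poly (z m) c \<noteq> 0"
    proof -
      have "poly ([:-c', 1:] ^ n) c \<noteq> 0" using endpoints by auto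
      then show ?thesis
        using flat_coeff_at_zero[of m m "[:-c', 1:] ^ n" c] unfolding z_def by auto
    qed
    ultimately show ?case
      using sub(1)[of "poly (z m) c *\<^sub>R T k" "inverse (poly (z m) c)"] by simp
  qed
  have "J (T k) \<in> steerable A B"
  proof (induction k rule: less_induct)
    case (less k)
    show ?case
    proof (cases "k < n")
      case False
      \<comment> \<open>Applying the \<open>j\<close>-th power of \<open>A\<close> to the relation
        writes \<open>T k\<close> through vectors \<open>T (j + i)\<close> with
        \<open>j + i < k\<close>.\<close>
      then obtain j where k: "k = j + n" by (metis add.commute le_add_diff_inverse2 not_less)
      have "T (j + i) = (((*v) A) ^^ j) (T i)" for i
        by (simp add: T_def funpow_add)
      moreover have "linear (((*v) A) ^^ j)"
        by (induction j)
          (auto intro!: linearI simp: linear_add linear_scale matrix_vector_right_distrib matrix_vector_mult_scaleR)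
      ultimately have "T k = (\<Sum>i<n. a i *\<^sub>R T (j + i))"
        unfolding k by (simp add: rel linear_sum linear_scale)
      moreover have "T (j + i) \<in> J -` steerable A B" if "i < n" for i
        using less.IH[of "j + i"] that k by simp
      then have "(\<Sum>i<n. a i *\<^sub>R T (j + i)) \<in> J -` steerable A B"
        by (intro sub(1,2)) simp
      ultimately show ?thesis by simp
    qed (rule low)
  qed
  then show ?thesis by (simp add: T_def)
qed

text \<open>The Krylov vectors span, so every \<open>(x0, 0)\<close> and every
  \<open>(0, x1)\<close> is steerable. The two trajectories are superposed on the same interval, not
  run one after the other.\<close>

lemma controllable_if_kalman:
  fixes A :: "real ^ 'd ^ 'd" and B :: "real ^ 'm ^ 'd"
  assumes "span {(((*v) A) ^^ k) (B *v e) | k e. True} = UNIV"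
  shows "controllable A B"
proof (rule controllable_if_steerable_UNIV)
  have ends: "J v \<in> steerable A B"
    if "(J = (\<lambda>v. (v, 0)) \<and> c = 0 \<and> c' = 1) \<or> (J = (\<lambda>v. (0, v)) \<and> c = 1 \<and> c' = 0)"
    for J v and c c' :: real
  proof -
    have "linear J" using that by (auto intro!: linearI)
    then have "subspace (J -` steerable A B)"
      using subspace_steerable by (rule linear_subspace_vimage)
    moreover have "{(((*v) A) ^^ k) (B *v e) | k e. True} \<subseteq> J -` steerable A B"
      using krylov_end_steerable[OF that] by auto
    ultimately have "span {(((*v) A) ^^ k) (B *v e) | k e. True} \<subseteq> J -` steerable A B"
      by (rule span_minimal[rotated])
    then show ?thesis unfolding assms by auto
  qed
  have "(x0, x1) \<in> steerable A B" for x0 x1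
    using subspace_add[OF subspace_steerable ends[of "\<lambda>v. (v, 0)" 0 1 x0] ends[of "\<lambda>v. (0, v)" 1 0 x1]]
    by simp
  then show "steerable A B = UNIV" by auto
qed

section \<open>The Popov--Belevitch--Hautus test\<close>

text \<open>This is \<open>p(T) v\<close> by Horner's scheme, with complex scalars.\<close>

definition poly_act :: "(complex ^ 'n \<Rightarrow> complex ^ 'n) \<Rightarrow> complex poly \<Rightarrow> complex ^ 'n \<Rightarrow> complex ^ 'n" where
  "poly_act T p v = fold_coeffs (\<lambda>a x. a *s v + T x) p 0"

lemma poly_act_0: "poly_act T 0 v = 0"
  by (simp add: poly_act_def)

lemma poly_act_pCons:
  assumes "T 0 = 0"
  shows "poly_act T (pCons a p) v = a *s v + T (poly_act T p v)"
  using assms by (cases "p = 0 \<and> a = 0") (auto simp: poly_act_def)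

lemma poly_act_add:
  assumes "Vector_Spaces.linear (*s) (*s) T"
  shows "poly_act T (p + q) v = poly_act T p v + poly_act T q v"
proof -
  interpret T: Vector_Spaces.linear "(*s)" "(*s)" T by (rule assms)
  show ?thesis
    by (induction p q rule: poly_induct2)
      (simp_all add: poly_act_0 poly_act_pCons T.zero T.add vector_sadd_rdistrib)
qed

lemma poly_act_smult:
  assumes "Vector_Spaces.linear (*s) (*s) T"
  shows "poly_act T (smult c p) v = c *s poly_act T p v"
proof -
  interpret T: Vector_Spaces.linear "(*s)" "(*s)" T by (rule assms)
  show ?thesis
    by (induction p)
      (simp_all add: poly_act_0 poly_act_pCons T.zero T.scale vector_add_ldistrib vector_smult_assoc)
qed

lemma poly_act_monom:
  assumes "Vector_Spaces.linear (*s) (*s) T"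
  shows "poly_act T (monom a k) v = a *s (T ^^ k) v"
proof -
  interpret T: Vector_Spaces.linear "(*s)" "(*s)" T by (rule assms)
  show ?thesis
    by (induction k) (simp_all add: monom_0 monom_Suc poly_act_0 poly_act_pCons T.zero T.scale)
qed

text \<open>Synthetic division gives \<open>p + l q = X q + p(l)\<close>, hence
  \<open>p(T) = (T - l) q(T)\<close> at a root \<open>l\<close>.\<close>

lemma poly_act_root_factor:
  assumes "Vector_Spaces.linear (*s) (*s) T" "poly p l = 0"
  shows "poly_act T p v = T (poly_act T (synthetic_div p l) v) - l *s poly_act T (synthetic_div p l) v"
proof -
  interpret T: Vector_Spaces.linear "(*s)" "(*s)" T by (rule assms)
  have "poly_act T (p + smult l (synthetic_div p l)) v = T (poly_act T (synthetic_div p l) v)"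
    by (simp add: synthetic_div_correct assms poly_act_pCons T.zero)
  then show ?thesis
    by (simp add: poly_act_add[OF assms(1)] poly_act_smult[OF assms(1)] algebra_simps)
qed

lemma poly_act_mem:
  assumes "T 0 = 0" "0 \<in> N" "v \<in> N" "\<And>x y. x \<in> N \<Longrightarrow> y \<in> N \<Longrightarrow> x + y \<in> N"
    "\<And>c x. x \<in> N \<Longrightarrow> c *s x \<in> N" "\<And>x. x \<in> N \<Longrightarrow> T x \<in> N"
  shows "poly_act T p v \<in> N"
  by (induction p) (simp_all add: assms poly_act_0 poly_act_pCons)

text \<open>A Krylov relation yields a nonzero polynomial \<open>p\<close> with
  \<open>p(T) v = 0\<close>. Roots are split off one at a time until the quotient no longer
  annihilates \<open>v\<close>; its value at \<open>v\<close> is then an eigenvector.\<close>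

lemma eigenvector_in_invariant_subspace:
  fixes T :: "complex ^ 'n \<Rightarrow> complex ^ 'n"
  assumes T: "Vector_Spaces.linear (*s) (*s) T"
    and N: "0 \<in> N" "\<And>x y. x \<in> N \<Longrightarrow> y \<in> N \<Longrightarrow> x + y \<in> N"
    "\<And>c x. x \<in> N \<Longrightarrow> c *s x \<in> N" "\<And>x. x \<in> N \<Longrightarrow> T x \<in> N"
    and v: "v \<in> N" "v \<noteq> 0"
  shows "\<exists>l. \<exists>x\<in>N. x \<noteq> 0 \<and> T x = l *s x"
proof -
  interpret T: Vector_Spaces.linear "(*s)" "(*s)" T by (rule T)
  obtain n a where rel: "(T ^^ n) v = (\<Sum>k<n. a k *\<^sub>R (T ^^ k) v)"
    using krylov_relation[of "\<lambda>k. (T ^^ k) v"] by blast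
  define p where "p = monom 1 n - (\<Sum>k<n. monom (complex_of_real (a k)) k)"
  have poly_act_sum: "poly_act T (\<Sum>k\<in>I. f k) v = (\<Sum>k\<in>I. poly_act T (f k) v)" for f and I :: "nat set"
    by (induction I rule: infinite_finite_induct) (simp_all add: poly_act_0 poly_act_add[OF T])
  have "poly_act T (monom 1 n) v = poly_act T (p + (\<Sum>k<n. monom (complex_of_real (a k)) k)) v"
    by (simp add: p_def)
  also have "\<dots> = poly_act T p v + (\<Sum>k<n. a k *\<^sub>R (T ^^ k) v)"
    by (simp add: poly_act_add[OF T] poly_act_sum poly_act_monom[OF T] vec_eq_iff)
      (simp add: scaleR_conv_of_real)
  finally have "poly_act T p v = 0"
    using rel by (simp add: poly_act_monom[OF T])
  moreover have "coeff p n = 1"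
    by (simp add: p_def coeff_sum)
  then have "p \<noteq> 0" by auto
  ultimately show ?thesis
  proof (induction "degree p" arbitrary: p rule: less_induct)
    case less
    show ?case
    proof (cases "degree p = 0")
      case True
      then obtain c where "p = [:c:]" by (metis degree_eq_zeroE)
      with less.prems v show ?thesis
        by (simp add: poly_act_pCons poly_act_0 T.zero)
    next
      case False
      then obtain l where l: "poly p l = 0"
        using fundamental_theorem_of_algebra[of p] by (auto simp: constant_degree)
      define r where "r = synthetic_div p l"
      define x where "x = poly_act T r v"
      have x: "x \<in> N" unfolding x_def
        by (rule poly_act_mem) (use N v T.zero in auto)
      have Tx: "T x = l *s x"
        using poly_act_root_factor[OF T l, of v] less.prems(1) by (simp add: x_def r_def)
      show ?thesis
      proof (cases "x = 0")
        case True
        have "degree r < degree p" using False by (simp add: r_def degree_synthetic_div)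
        moreover have "r \<noteq> 0" using False by (simp add: r_def synthetic_div_eq_0_iff)
        ultimately show ?thesis using less.hyps[of r] True by (simp add: x_def)
      qed (use x Tx in blast)
    qed
  qed
qed

text \<open>A proper Krylov span has a nonzero real vector orthogonal to it. Complexified, it lies
  in the largest \<open>A\<close>-invariant space of row vectors that annihilate \<open>B\<close>,
  and an eigenvector in that space contradicts the test.\<close>

lemma controllable_if_hautus:
  fixes A :: "real ^ 'd ^ 'd" and B :: "real ^ 'm ^ 'd"
  assumes hautus: "\<And>l (v :: complex ^ 'd).
      (\<And>j. (\<Sum>i\<in>UNIV. v $ i * of_real (A $ i $ j)) = l * v $ j) \<Longrightarrow>
      (\<And>k. (\<Sum>i\<in>UNIV. v $ i * of_real (B $ i $ k)) = 0) \<Longrightarrow> v = 0"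
  shows "controllable A B"
proof (rule controllable_if_kalman, rule ccontr)
  let ?K = "{(((*v) A) ^^ k) (B *v e) | k e. True}"
  assume "span ?K \<noteq> UNIV"
  then have "dim ?K < DIM(real ^ 'd)"
    using dim_eq_full[of ?K] dim_subset_UNIV[of ?K] by linarith
  then obtain p where p: "p \<noteq> 0" and "\<And>y. y \<in> span ?K \<Longrightarrow> orthogonal p y"
    by (rule orthogonal_to_subspace_exists) blast
  then have orth: "p \<bullet> y = 0" if "y \<in> ?K" for y
    using span_base[OF that] unfolding orthogonal_def by blast
  \<comment> \<open>\<open>T\<close> and \<open>C\<close> multiply a row vector by \<open>A\<close>
    and by \<open>B\<close> from the right.\<close>
  define T :: "complex ^ 'd \<Rightarrow> complex ^ 'd" where
    "T = (\<lambda>v. \<chi> j. \<Sum>i\<in>UNIV. v $ i * of_real (A $ i $ j))"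
  define C :: "complex ^ 'd \<Rightarrow> 'm \<Rightarrow> complex" where
    "C = (\<lambda>v k. \<Sum>i\<in>UNIV. v $ i * of_real (B $ i $ k))"
  define N where "N = {v. \<forall>n k. C ((T ^^ n) v) k = 0}"
  have T: "Vector_Spaces.linear (*s) (*s) T"
    by unfold_locales
      (auto simp: T_def vec_eq_iff algebra_simps sum.distrib sum_distrib_left)
  then interpret T: Vector_Spaces.linear "(*s)" "(*s)" T .
  have Tn: "(T ^^ n) (x + y) = (T ^^ n) x + (T ^^ n) y" "(T ^^ n) (c *s x) = c *s (T ^^ n) x"
    "(T ^^ n) 0 = 0" for n x y c
    by (induction n) (simp_all add: T.add T.scale T.zero)
  define complexify :: "real ^ 'd \<Rightarrow> complex ^ 'd" where "complexify = (\<lambda>q. \<chi> i. of_real (q $ i))"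
  have T_pow: "(T ^^ n) (complexify q) = complexify (((\<lambda>q. q v* A) ^^ n) q)" for n q
    by (induction n) (simp_all add: T_def complexify_def vec_eq_iff vector_matrix_mult_def mult.commute)
  have pow_inner: "(((\<lambda>q. q v* A) ^^ n) q) \<bullet> y = q \<bullet> (((*v) A) ^^ n) y" for n q y
    by (induction n arbitrary: y) (simp_all add: dot_lmul_matrix funpow_swap1)
  have "C ((T ^^ n) (complexify p)) k = 0" for n k
  proof -
    have "C ((T ^^ n) (complexify p)) k = of_real ((((\<lambda>q. q v* A) ^^ n) p) \<bullet> (B *v axis k 1))"
      unfolding T_pow by (simp add: C_def complexify_def inner_vec_def column_def matrix_vector_mult_basis)
    also have "\<dots> = 0"
      unfolding pow_inner using orth by auto
    finally show ?thesis .
  qed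
  then have pN: "complexify p \<in> N" by (simp add: N_def)
  have p0: "complexify p \<noteq> 0"
    using p by (auto simp: complexify_def vec_eq_iff)
  have NT: "T x \<in> N" if "x \<in> N" for x
  proof -
    have "C ((T ^^ n) (T x)) k = C ((T ^^ Suc n) x) k" for n k
      by (simp add: funpow_swap1)
    then show ?thesis using that unfolding N_def mem_Collect_eq by metis
  qed
  have "C (x + y) k = C x k + C y k" "C (c *s x) k = c * C x k" "C 0 k = 0" for x y c k
    by (simp_all add: C_def ring_distribs sum.distrib sum_distrib_left mult.assoc)
  then have N: "0 \<in> N" "\<And>x y. x \<in> N \<Longrightarrow> y \<in> N \<Longrightarrow> x + y \<in> N" "\<And>c x. x \<in> N \<Longrightarrow> c *s x \<in> N"
    unfolding N_def by (simp_all add: Tn)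
  obtain l x where x: "x \<in> N" "x \<noteq> 0" "T x = l *s x"
    using eigenvector_in_invariant_subspace[OF T N NT pN p0] by blast
  have "\<forall>n k. C ((T ^^ n) x) k = 0"
    using x(1) by (simp add: N_def)
  then have "C x k = 0" for k by (metis funpow_0)
  moreover have "T x $ j = l * x $ j" for j
    by (simp add: x(3))
  ultimately show False
    using hautus[of x l] x(2) by (simp add: T_def C_def)
qed

section \<open>Source components need an input\<close>

text \<open>Without an input into \<open>S\<close>, the squared norm \<open>y\<close> of the
  coordinates in \<open>S\<close> obeys the Gronwall inequality \<open>y' <= M y\<close>. Starting
  from 0 it stays 0, so a unit vector in \<open>S\<close> is out of reach.\<close>

lemma controllable_imp_input_into_closed_set:
  fixes A :: "real ^ 'd ^ 'd" and B :: "real ^ 'm ^ 'd"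
  assumes ctrl: "controllable A B" and "S \<noteq> {}"
    and closed: "\<And>i j. i \<in> S \<Longrightarrow> j \<notin> S \<Longrightarrow> A $ i $ j = 0"
  shows "\<exists>i\<in>S. \<exists>k. B $ i $ k \<noteq> 0"
proof (rule ccontr)
  assume "\<not> ?thesis"
  then have B0: "B $ i $ k = 0" if "i \<in> S" for i k using that by blast
  obtain s where s: "s \<in> S" using \<open>S \<noteq> {}\<close> by blast
  obtain T u x where T: "T > 0" and ends: "x 0 = 0" "x T = axis s (1::real)"
    and deriv: "\<And>t. t \<in> {0..T} \<Longrightarrow>
      (x has_vector_derivative (A *v x t + B *v u t)) (at t within {0..T})"
    using ctrl unfolding controllable_def by metis
  have row: "(A *v x t + B *v u t) $ i = (\<Sum>j\<in>S. A $ i $ j * x t $ j)" if "i \<in> S" for t i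
  proof -
    have "(A *v x t + B *v u t) $ i = (\<Sum>j\<in>UNIV. A $ i $ j * x t $ j)"
      by (simp add: matrix_vector_mult_def B0 that)
    also have "\<dots> = (\<Sum>j\<in>S. A $ i $ j * x t $ j)"
      by (rule sum.mono_neutral_right) (auto simp: closed that)
    finally show ?thesis .
  qed
  have coord: "((\<lambda>t. x t $ i) has_real_derivative (\<Sum>j\<in>S. A $ i $ j * x t $ j)) (at t within {0..T})"
    if "i \<in> S" "t \<in> {0..T}" for i t
    using bounded_linear.has_vector_derivative[OF bounded_linear_vec_nth[of i] deriv[OF that(2)]]
      row[OF that(1), of t]
    by (simp add: has_real_derivative_iff_has_vector_derivative)
  define y where "y = (\<lambda>t. \<Sum>i\<in>S. (x t $ i)\<^sup>2)"
  define y' where "y' = (\<lambda>t. \<Sum>i\<in>S. 2 * x t $ i * (\<Sum>j\<in>S. A $ i $ j * x t $ j))"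
  \<comment> \<open>Each product of two coordinates is at most \<open>y\<close> in modulus, so
    \<open>M\<close> collects the coefficients of the quadratic form \<open>y'\<close>.\<close>
  define M where "M = (\<Sum>i\<in>S. \<Sum>j\<in>S. 2 * \<bar>A $ i $ j\<bar>)"
  have y: "(y has_real_derivative y' t) (at t within {0..T})" if "t \<in> {0..T}" for t
    unfolding y_def y'_def
    by (rule DERIV_sum) (auto intro!: derivative_eq_intros coord that simp: power2_eq_square)
  have bound: "y' t \<le> M * y t" for t
  proof -
    have "2 * x t $ i * (A $ i $ j * x t $ j) \<le> 2 * \<bar>A $ i $ j\<bar> * y t" if "i \<in> S" "j \<in> S" for i j
    proof -
      have "(x t $ l)\<^sup>2 \<le> y t" if "l \<in> S" for l
        unfolding y_def using that by (intro member_le_sum) auto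
      then have "\<bar>x t $ i\<bar> \<le> sqrt (y t)" "\<bar>x t $ j\<bar> \<le> sqrt (y t)"
        using that by (auto intro!: real_le_rsqrt)
      then have "\<bar>x t $ i\<bar> * \<bar>x t $ j\<bar> \<le> sqrt (y t) * sqrt (y t)"
        by (intro mult_mono) (auto simp: y_def intro: sum_nonneg)
      also have "\<dots> = y t" by (simp add: y_def sum_nonneg)
      finally have "\<bar>x t $ i * x t $ j\<bar> \<le> y t" by (simp add: abs_mult)
      then have "2 * \<bar>A $ i $ j\<bar> * \<bar>x t $ i * x t $ j\<bar> \<le> 2 * \<bar>A $ i $ j\<bar> * y t"
        by (intro mult_left_mono) auto
      moreover have "2 * x t $ i * (A $ i $ j * x t $ j) \<le> \<bar>2 * x t $ i * (A $ i $ j * x t $ j)\<bar>"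
        by (rule abs_ge_self)
      moreover have "\<bar>2 * x t $ i * (A $ i $ j * x t $ j)\<bar> = 2 * \<bar>A $ i $ j\<bar> * \<bar>x t $ i * x t $ j\<bar>"
        by (simp add: abs_mult)
      ultimately show ?thesis by linarith
    qed
    then show ?thesis
      unfolding y'_def M_def sum_distrib_left sum_distrib_right by (intro sum_mono)
  qed
  define g where "g = (\<lambda>t. exp (- M * t) * y t)"
  have "(g has_derivative (\<lambda>h. h * (exp (- M * t) * (y' t - M * y t)))) (at t within {0..T})"
    if "t \<in> {0..T}" for t
  proof -
    have "(g has_real_derivative (exp (- M * t) * (y' t - M * y t))) (at t within {0..T})"
      unfolding g_def by (auto intro!: derivative_eq_intros y that simp: algebra_simps)
    then show ?thesis by (simp add: has_field_derivative_def mult_commute_abs)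
  qed
  then obtain t where "g T - g 0 = (T - 0) * (exp (- M * t) * (y' t - M * y t))"
    using mvt_simple[OF T, of g "\<lambda>t h. h * (exp (- M * t) * (y' t - M * y t))"] by auto
  also have "\<dots> \<le> 0"
    using bound[of t] T by (simp add: mult_nonneg_nonpos)
  finally have "g T \<le> 0" by (simp add: g_def y_def ends)
  then have "y T \<le> 0" by (simp add: g_def mult_le_0_iff)
  moreover have "y T = 1"
    unfolding y_def ends using s by (simp add: axis_def if_distrib[of "\<lambda>a. a\<^sup>2"] cong: if_cong)
  ultimately show False by simp
qed

section \<open>Forests of cycles are controllable\<close>

text \<open>The value of \<open>c\<close> is both the weight and the label of a cycle of
  \<open>p\<close>. \<open>rank\<close> is the depth of a cycle in the forest; \<open>E\<close>
  holds one entry vertex per cycle, fed from \<open>par\<close> in the parent cycle or, at a root,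
  by the input \<open>inp\<close>.\<close>

locale cycle_forest =
  fixes p :: "'d::finite \<Rightarrow> 'd" and c :: "'d \<Rightarrow> real" and rank :: "'d \<Rightarrow> nat"
    and E :: "'d set" and par :: "'d \<Rightarrow> 'd" and inp :: "'d \<Rightarrow> 'm::finite"
  assumes inj_p: "inj p"
    and c_pos: "c i > 0"
    and c_eq_iff: "c i = c j \<longleftrightarrow> (\<exists>n. (p ^^ n) i = j)"
    and rank_cong: "c i = c j \<Longrightarrow> rank i = rank j"
    and entry: "\<exists>e\<in>E. c e = c i"
    and entry_unique: "e \<in> E \<Longrightarrow> e' \<in> E \<Longrightarrow> c e = c e' \<Longrightarrow> e = e'"
    and rank_par: "e \<in> E \<Longrightarrow> rank e > 0 \<Longrightarrow> rank e = Suc (rank (par e))"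
begin

text \<open>The two summands are never both nonzero, because \<open>p\<close> preserves
  \<open>rank\<close> while \<open>par\<close> lowers it.\<close>

definition state_matrix :: "real ^ 'd ^ 'd" where
  "state_matrix = (\<chi> i j. (if i = p j then c j else 0) +
      (if i \<in> E \<and> rank i > 0 \<and> par i = j then 1 else 0))"

definition input_matrix :: "real ^ 'm ^ 'd" where
  "input_matrix = (\<chi> i k. if i \<in> E \<and> rank i = 0 \<and> inp i = k then 1 else 0)"

section \<open>Walks around a single cycle\<close>

lemma c_p [simp]: "c (p i) = c i"
  using c_eq_iff[of i "p i"] by (metis funpow_0 funpow_Suc_right o_apply)

lemma rank_p [simp]: "rank (p i) = rank i"
  by (rule rank_cong) simp

lemma c_funpow [simp]: "c ((p ^^ n) i) = c i"
  by (induction n) auto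

text \<open>The iterates of \<open>p\<close> are followed from \<open>i\<close> until they meet
  \<open>j\<close>, so the step out of \<open>j\<close> is exempt; that is where the equations of a
  forced cycle carry an extra term.\<close>

lemma propagate:
  assumes "P i" "c i = c j"
    and step: "\<And>x. c x = c j \<Longrightarrow> x \<noteq> j \<Longrightarrow> P x \<Longrightarrow> P (p x)"
  shows "P j"
proof -
  obtain n where n: "(p ^^ n) i = j" using assms(2) c_eq_iff by blast
  have "P j \<or> P ((p ^^ m) i)" for m
  proof (induction m)
    case (Suc m)
    then show ?case using step[of "(p ^^ m) i"] assms(2) by (cases "(p ^^ m) i = j") auto
  qed (use assms in simp)
  from this[of n] n show ?thesis by simp
qed

text \<open>Each step along the cycle scales the modulus of the entry by
  \<open>norm l / c i\<close>; the return to \<open>i\<close> forces this factor to be 1.\<close>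

lemma homogeneous_cycle:
  fixes v :: "'d \<Rightarrow> complex"
  assumes hom: "\<And>x. c x = c i \<Longrightarrow> of_real (c x) * v (p x) = l * v x"
    and "v i \<noteq> 0"
  shows "norm l = c i" "\<And>x. c x = c i \<Longrightarrow> v x \<noteq> 0"
proof -
  have pow: "norm (v ((p ^^ n) i)) = (norm l / c i) ^ n * norm (v i)" for n
  proof (induction n)
    case (Suc n)
    have "norm (of_real (c i) * v (p ((p ^^ n) i))) = norm (l * v ((p ^^ n) i))"
      using hom[of "(p ^^ n) i"] by simp
    then show ?case
      using Suc c_pos[of i] by (simp add: norm_mult field_simps)
  qed simp
  obtain n where n: "n > 0" "(p ^^ n) i = i"
    using funpow_inj_finite[OF inj_p, of i] by auto
  have "(norm l / c i) ^ n = 1"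
    using pow[of n] n \<open>v i \<noteq> 0\<close> by simp
  then have "norm l / c i = 1"
    using power_eq_imp_eq_base[of "norm l / c i" n 1] n c_pos[of i] by (simp add: less_imp_le)
  then show "norm l = c i" using c_pos[of i] by simp
  fix x assume "c x = c i"
  then obtain m where "(p ^^ m) i = x" using c_eq_iff[of i x] by auto
  then show "v x \<noteq> 0"
    using pow[of m] \<open>v i \<noteq> 0\<close> \<open>norm l / c i = 1\<close> by auto
qed

text \<open>A zero anywhere would propagate to \<open>q\<close>. The forcing then makes the entry at
  \<open>p q\<close> nonzero, and this propagates round the cycle to \<open>q\<close>, a
  contradiction.\<close>

lemma forced_cycle:
  fixes v :: "'d \<Rightarrow> complex"
  assumes eq: "\<And>x. c x = c q \<Longrightarrow> of_real (c x) * v (p x) + (if x = q then b else 0) = l * v x"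
    and "b \<noteq> 0" "l \<noteq> 0" "c x = c q"
  shows "v x \<noteq> 0"
proof
  assume "v x = 0"
  have step: "v (p z) = 0 \<longleftrightarrow> v z = 0" if "c z = c q" "z \<noteq> q" for z
    using eq[OF that(1)] that(2) c_pos[of z] \<open>l \<noteq> 0\<close> by auto
  have "v q = 0"
    using propagate[of "\<lambda>z. v z = 0" x q] \<open>v x = 0\<close> \<open>c x = c q\<close> step by auto
  then have "v (p q) \<noteq> 0"
    using eq[of q] \<open>b \<noteq> 0\<close> by auto
  then have "v q \<noteq> 0"
    using propagate[of "\<lambda>z. v z \<noteq> 0" "p q" q] step by auto
  with \<open>v q = 0\<close> show False by simp
qed

lemma hautus_test:
  fixes v :: "complex ^ 'd"
  assumes eigen: "\<And>j. (\<Sum>i\<in>UNIV. v $ i * of_real (state_matrix $ i $ j)) = l * v $ j"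
    and input: "\<And>k. (\<Sum>i\<in>UNIV. v $ i * of_real (input_matrix $ i $ k)) = 0"
  shows "v = 0"
proof (rule ccontr)
  assume "v \<noteq> 0"
  \<comment> \<open>Column \<open>j\<close> of the left eigenvector equation involves the successors
    of \<open>j\<close>: \<open>p j\<close> and the entry vertices fed from
    \<open>j\<close>.\<close>
  have eq: "of_real (c j) * v $ (p j) + (\<Sum>i | i \<in> E \<and> rank i > 0 \<and> par i = j. v $ i) = l * v $ j" for j
  proof -
    have "v $ i * of_real (state_matrix $ i $ j) = (if i = p j then of_real (c j) * v $ i else 0) +
        (if i \<in> E \<and> rank i > 0 \<and> par i = j then v $ i else 0)" for i
      by (simp add: state_matrix_def ring_distribs)
    then show ?thesis
      using eigen[of j] by (simp add: sum.distrib sum.If_cases)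
  qed
  have hom: "of_real (c j) * v $ (p j) = l * v $ j"
    if "\<And>i. i \<in> E \<Longrightarrow> rank i = Suc (rank j) \<Longrightarrow> par i = j \<Longrightarrow> v $ i = 0" for j
  proof -
    have "(\<Sum>i | i \<in> E \<and> rank i > 0 \<and> par i = j. v $ i) = 0"
      by (rule sum.neutral) (use that rank_par in auto)
    then show ?thesis using eq[of j] by simp
  qed
  define R where "R = Max (rank ` {i. v $ i \<noteq> 0})"
  have ne: "{i. v $ i \<noteq> 0} \<noteq> {}" using \<open>v \<noteq> 0\<close> by (auto simp: vec_eq_iff)
  then have "R \<in> rank ` {i. v $ i \<noteq> 0}"
    unfolding R_def by (intro Max_in) auto
  then obtain t where t: "v $ t \<noteq> 0" "rank t = R" by auto
  have top: "v $ i = 0" if "rank i > R" for i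
    using that Max_ge[of "rank ` {i. v $ i \<noteq> 0}" "rank i"] unfolding R_def by fastforce
  have hom_top: "of_real (c x) * v $ (p x) = l * v $ x" if "rank j = R" "c x = c j" for j x
    by (rule hom) (use rank_cong[OF that(2)] that(1) top in simp)
  \<comment> \<open>No nonzero entries sit above rank \<open>R\<close>, so the cycle of
    \<open>t\<close> is homogeneous and fixes the modulus of \<open>l\<close>.\<close>
  have l: "norm l = c t"
    by (rule homogeneous_cycle(1)[OF hom_top[OF t(2)] t(1)])
  \<comment> \<open>Descending through the ranks, the support meets each of them in exactly one
    cycle.\<close>
  have "\<exists>i. rank i = R - k \<and> (\<forall>j. rank j = R - k \<longrightarrow> (v $ j \<noteq> 0 \<longleftrightarrow> c j = c i))" if "k \<le> R" for k
    using that
  proof (induction k)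
    case 0
    have "v $ j \<noteq> 0 \<longleftrightarrow> c j = c t" if "rank j = R" for j
    proof
      assume nz: "v $ j \<noteq> 0"
      have "norm l = c j"
        by (rule homogeneous_cycle(1)[OF hom_top[OF that] nz])
      then show "c j = c t" using l by simp
    next
      assume cj: "c j = c t"
      show "v $ j \<noteq> 0"
        by (rule homogeneous_cycle(2)[OF hom_top[OF t(2)] t(1) cj])
    qed
    then show ?case using t by auto
  next
    case (Suc k)
    define r where "r = R - Suc k"
    have r: "R - k = Suc r" "r < R" using Suc.prems by (auto simp: r_def)
    obtain i where i: "rank i = Suc r" "\<And>j. rank j = Suc r \<Longrightarrow> v $ j \<noteq> 0 \<longleftrightarrow> c j = c i"
      using Suc r by auto
    obtain e where e: "e \<in> E" "c e = c i" using entry by blast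
    have rank_e: "rank e = Suc r" using rank_cong[OF e(2)] i(1) by simp
    then have ve: "v $ e \<noteq> 0" using i(2) e(2) by blast
    define q where "q = par e"
    have q: "rank q = r" using rank_par[OF e(1)] rank_e by (simp add: q_def)
    \<comment> \<open>Of the entry vertices one rank up only \<open>e\<close> lies in the support,
      so at rank \<open>r\<close> only the cycle of \<open>q\<close> is forced.\<close>
    have child: "a = e" if "a \<in> E" "rank a = Suc r" "v $ a \<noteq> 0" for a
      using that e i(2) entry_unique by metis
    have "v $ j \<noteq> 0 \<longleftrightarrow> c j = c q" if j: "rank j = r" for j
    proof (cases "c j = c q")
      case True
      have "of_real (c x) * v $ (p x) + (if x = q then v $ e else 0) = l * v $ x" if "c x = c q" for x
      proof -
        have x: "rank x = r" using rank_cong[OF that] q by simp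
        show ?thesis
        proof (cases "x = q")
          case True
          have "v $ a = 0" if "a \<in> E" "rank a > 0" "par a = q" "a \<noteq> e" for a
          proof -
            have "rank a = Suc r" using rank_par[OF that(1,2)] that(3) q by simp
            then show ?thesis using child[OF that(1)] that(4) by blast
          qed
          then have "(\<Sum>a | a \<in> E \<and> rank a > 0 \<and> par a = q. v $ a) = (\<Sum>a\<in>{e}. v $ a)"
            by (intro sum.mono_neutral_right) (use e rank_e in \<open>auto simp: q_def\<close>)
          then show ?thesis using eq[of q] True by simp
        next
          case False
          have "of_real (c x) * v $ (p x) = l * v $ x"
          proof (rule hom)
            fix a assume a: "a \<in> E" "rank a = Suc (rank x)" "par a = x"
            then have "a \<noteq> e" using False by (auto simp: q_def)
            then show "v $ a = 0" using child[of a] a x by auto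
          qed
          then show ?thesis using False by simp
        qed
      qed
      moreover have "l \<noteq> 0" using l c_pos[of t] by auto
      ultimately have "v $ j \<noteq> 0"
        using forced_cycle[of q "($) v" "v $ e" l j] ve True by auto
      then show ?thesis using True by simp
    next
      case False
      \<comment> \<open>An unforced cycle in the support would have weight \<open>norm l\<close>,
        hence be the cycle of \<open>t\<close>, whose rank is larger.\<close>
      have "v $ j = 0"
      proof (rule ccontr)
        assume "v $ j \<noteq> 0"
        moreover have "of_real (c x) * v $ (p x) = l * v $ x" if "c x = c j" for x
        proof (rule hom)
          fix a assume a: "a \<in> E" "rank a = Suc (rank x)" "par a = x"
          then have "a \<noteq> e" using that False by (auto simp: q_def)
          then show "v $ a = 0" using child a rank_cong[OF that] j by auto
        qed
        ultimately have "norm l = c j"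
          by (intro homogeneous_cycle(1)[of j "($) v" l])
        then have "rank j = rank t" using l rank_cong[of j t] by simp
        then show False using j t r by simp
      qed
      then show ?thesis using False by simp
    qed
    then show ?case using q unfolding r_def by blast
  qed
  from this[of R] obtain i where i: "rank i = 0" "\<And>j. rank j = 0 \<Longrightarrow> v $ j \<noteq> 0 \<longleftrightarrow> c j = c i"
    by auto
  obtain e where e: "e \<in> E" "c e = c i" using entry by blast
  have rank_e: "rank e = 0" using rank_cong[OF e(2)] i(1) by simp
  \<comment> \<open>Several roots may share an input, but the entry vertices of the others lie
    outside the support, so nothing cancels \<open>v $ e\<close>.\<close>
  have "v $ a = 0" if "a \<in> E" "rank a = 0" "a \<noteq> e" for a
    using that e i(2) entry_unique by metis
  then have "(\<Sum>a | a \<in> E \<and> rank a = 0 \<and> inp a = inp e. v $ a) = (\<Sum>a\<in>{e}. v $ a)"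
    by (intro sum.mono_neutral_right) (use e rank_e in auto)
  moreover have "(\<Sum>a | a \<in> E \<and> rank a = 0 \<and> inp a = inp e. v $ a) = 0"
  proof -
    have "v $ a * of_real (input_matrix $ a $ inp e) =
        (if a \<in> E \<and> rank a = 0 \<and> inp a = inp e then v $ a else 0)" for a
      by (simp add: input_matrix_def)
    then show ?thesis using input[of "inp e"] by (simp add: sum.If_cases)
  qed
  ultimately show False using i(2)[OF rank_e] e(2) by simp
qed

lemma controllable: "controllable state_matrix input_matrix"
  by (rule controllable_if_hautus) (rule hautus_test)

end

section \<open>Source strongly connected components\<close>

text \<open>\<open>p j\<close> is the partner of \<open>j\<close>; matching edges that share an
  endpoint coincide, which makes \<open>p\<close> injective.\<close>

lemma perfect_matching_imp_permutation:
  assumes "perfect_matching UNIV (bipartite_edges A) M"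
  shows "\<exists>p. inj p \<and> (\<forall>j. A $ (p j) $ j \<noteq> Zero)"
proof -
  have M: "M \<subseteq> bipartite_edges A" "pairwise disjnt M" "UNIV \<subseteq> \<Union>M"
    using assms unfolding perfect_matching_def matching_def by blast+
  have "\<exists>i. {Inl j, Inr i} \<in> M \<and> A $ i $ j \<noteq> Zero" for j
  proof -
    obtain e where e: "e \<in> M" "Inl j \<in> e" using M(3) by blast
    then have "e \<in> bipartite_edges A" using M(1) by blast
    then show ?thesis using e by (auto simp: bipartite_edges_def)
  qed
  then obtain p where p: "\<And>j. {Inl j, Inr (p j)} \<in> M" "\<And>j. A $ (p j) $ j \<noteq> Zero"
    by metis
  have "inj p"
  proof (rule injI)
    fix j j' assume "p j = p j'"
    then have "\<not> disjnt {Inl j, Inr (p j)} {Inl j', Inr (p j')}" by (simp add: disjnt_def)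
    then have "{Inl j, Inr (p j)} = {Inl j', Inr (p j')}"
      using M(2) p(1) by (meson pairwiseD)
    then show "j = j'" by (auto simp: doubleton_eq_iff)
  qed
  then show ?thesis using p(2) by blast
qed

section \<open>Strong components of the state digraph\<close>

lemma fin_digraph_state_digraph: "fin_digraph (state_digraph A)"
  by unfold_locales (auto simp: state_digraph_def)

lemma state_digraph_simps [simp]:
  "verts (state_digraph A) = UNIV" "arcs (state_digraph A) = {(j, i). A $ i $ j \<noteq> Zero}"
  "tail (state_digraph A) = fst" "head (state_digraph A) = snd"
  by (simp_all add: state_digraph_def)

lemma sccs_eq_if_common_vertex:
  assumes "S \<in> pre_digraph.sccs (state_digraph A)" "S' \<in> pre_digraph.sccs (state_digraph A)"
    and "i \<in> verts S" "i \<in> verts S'"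
  shows "S = S'"
proof -
  interpret fin_digraph "state_digraph A" by (rule fin_digraph_state_digraph)
  have "verts S \<in> sccs_verts" "verts S' \<in> sccs_verts"
    using assms by (auto simp: sccs_verts_conv)
  then have "verts S = verts S'"
    using sccs_verts_disjoint assms(3,4) by blast
  then show ?thesis using inj_on_verts_sccs assms(1,2) by (auto dest: inj_onD)
qed

lemma vertex_in_scc:
  "\<exists>S\<in>pre_digraph.sccs (state_digraph A). i \<in> verts S"
proof -
  interpret fin_digraph "state_digraph A" by (rule fin_digraph_state_digraph)
  have "scc_of i \<in> sccs_verts" "i \<in> scc_of i"
    using scc_of_in_sccs_verts in_scc_of_self by auto
  then show ?thesis by (auto simp: sccs_verts_conv)
qed

lemma sscc_predecessor:
  assumes S: "is_sscc (state_digraph A) S" and "i \<in> verts S" "A $ i $ j \<noteq> Zero"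
  shows "j \<in> verts S"
proof -
  obtain S' where S': "S' \<in> pre_digraph.sccs (state_digraph A)" "j \<in> verts S'"
    using vertex_in_scc by blast
  then have "S' = S"
    using assms unfolding is_sscc_def by fastforce
  with S' show ?thesis by simp
qed

lemma sscc_verts_nonempty: "is_sscc G S \<Longrightarrow> verts S \<noteq> {}"
  by (auto simp: is_sscc_def pre_digraph.sccs_def strongly_connected_def)

lemma finite_ssccs: "finite {S. is_sscc (state_digraph A) S}"
proof -
  interpret fin_digraph "state_digraph A" by (rule fin_digraph_state_digraph)
  have "finite sccs"
    by (rule finite_imageD[OF _ inj_on_verts_sccs]) (simp flip: sccs_verts_conv add: finite_sccs_verts)
  then show ?thesis by (rule rev_finite_subset) (auto simp: is_sscc_def)
qed

text \<open>The component of a vertex of \<open>U\<close> with the fewest ancestors is a source component.\<close>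

lemma sscc_in_predecessor_closed_set:
  assumes "U \<noteq> {}" and closed: "\<And>i j. i \<in> U \<Longrightarrow> A $ i $ j \<noteq> Zero \<Longrightarrow> j \<in> U"
  shows "\<exists>S. is_sscc (state_digraph A) S \<and> verts S \<subseteq> U"
proof -
  interpret fin_digraph "state_digraph A" by (rule fin_digraph_state_digraph)
  define anc where "anc = (\<lambda>i. {j. j \<rightarrow>\<^sup>*\<^bsub>state_digraph A\<^esub> i})"
  obtain u where u: "u \<in> U" "\<And>x. x \<in> U \<Longrightarrow> card (anc u) \<le> card (anc x)"
    using \<open>U \<noteq> {}\<close> ex_has_least_nat[of "\<lambda>x. x \<in> U" _ "\<lambda>x. card (anc x)"] by blast
  have arcI: "j \<rightarrow>\<^bsub>state_digraph A\<^esub> i" if "A $ i $ j \<noteq> Zero" for i j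
    using that by (force simp: arcs_ends_def arc_to_ends_def)
  have anc_U: "x \<in> U" if "x \<rightarrow>\<^sup>*\<^bsub>state_digraph A\<^esub> u" for x
    using that
  proof (induction rule: converse_reachable_induct)
    case (step x y)
    then show ?case using closed by (auto simp: arcs_ends_def arc_to_ends_def)
  qed (use u in auto)
  \<comment> \<open>Ancestors of an ancestor \<open>x\<close> of \<open>u\<close> are ancestors of
    \<open>u\<close>; by minimality both have the same ones, so \<open>u\<close> is an ancestor of
    \<open>x\<close>.\<close>
  have anc_eq: "anc u = scc_of u"
  proof -
    have "u \<rightarrow>\<^sup>*\<^bsub>state_digraph A\<^esub> x" if "x \<in> anc u" for x
    proof -
      have "anc x \<subseteq> anc u" using that by (auto simp: anc_def intro: reachable_trans)
      moreover have "card (anc u) \<le> card (anc x)" using u(2) anc_U that by (simp add: anc_def)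
      ultimately have "anc x = anc u" by (intro card_seteq) auto
      then have "u \<in> anc x" by (simp add: anc_def)
      then show ?thesis by (simp add: anc_def)
    qed
    then show ?thesis by (auto simp: anc_def scc_of_def)
  qed
  obtain S where S: "S \<in> sccs" "u \<in> verts S"
    using vertex_in_scc by blast
  have "scc_of u \<in> sccs_verts" "u \<in> scc_of u"
    using scc_of_in_sccs_verts in_scc_of_self by auto
  moreover have "verts S \<in> sccs_verts"
    using S by (auto simp: sccs_verts_conv)
  ultimately have verts_S: "verts S = anc u"
    unfolding anc_eq using sccs_verts_disjoint S(2) by blast
  have "is_sscc (state_digraph A) S"
    unfolding is_sscc_def
  proof (intro conjI notI S(1))
    assume "\<exists>S'\<in>sccs. S' \<noteq> S \<and> (\<exists>e\<in>arcs (state_digraph A).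
        tail (state_digraph A) e \<in> verts S' \<and> head (state_digraph A) e \<in> verts S)"
    then obtain S' j i where S': "S' \<in> sccs" "S' \<noteq> S" "A $ i $ j \<noteq> Zero" "j \<in> verts S'" "i \<in> verts S"
      by auto
    then have "j \<in> anc u"
      using arcI[OF S'(3)] unfolding verts_S anc_def by (auto intro: adj_reachable_trans)
    then show False
      using sccs_eq_if_common_vertex[OF S(1) S'(1), of j] S' verts_S by simp
  qed
  moreover have "verts S \<subseteq> U" using anc_U unfolding verts_S anc_def by auto
  ultimately show ?thesis by blast
qed

section \<open>Structural controllability in the presence of a perfect matching\<close>

lemma funpow_inj_return:
  fixes p :: "'a::finite \<Rightarrow> 'a"
  assumes "inj p"
  shows "\<exists>a. (p ^^ a) ((p ^^ m) j) = j"
proof -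
  obtain N where N: "N > 0" "(p ^^ N) j = j"
    using funpow_inj_finite[OF assms, of j] by auto
  have "(p ^^ (N * m)) j = j"
    by (induction m) (simp_all add: funpow_add N)
  moreover have "N * m = (N * m - m) + m" using N(1) by simp
  ultimately have "(p ^^ (N * m - m)) ((p ^^ m) j) = j"
    by (metis funpow_add o_apply)
  then show ?thesis by blast
qed

text \<open>Vertices are numbered injectively and a cycle takes the smallest number on it. Different
  cycles are disjoint, so these differ; adding 1 makes them positive.\<close>

lemma cycle_weights_exist:
  fixes p :: "'d::finite \<Rightarrow> 'd"
  assumes "inj p"
  obtains c :: "'d \<Rightarrow> real"
  where "\<And>i. c i > 0" "\<And>i j. c i = c j \<longleftrightarrow> (\<exists>n. (p ^^ n) i = j)"
proof -
  obtain g :: "'d \<Rightarrow> nat" where g: "inj g"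
    using finite_imp_inj_to_nat_seg[of "UNIV :: 'd set"] by auto
  define cyc where "cyc = (\<lambda>i. range (\<lambda>n. (p ^^ n) i))"
  define c where "c = (\<lambda>i. 1 + real (Min (g ` cyc i)))"
  have sub: "cyc ((p ^^ n) i) \<subseteq> cyc i" for n i
    unfolding cyc_def by (auto simp flip: funpow_add[THEN fun_cong, unfolded o_apply])
  show thesis
  proof
    show "c i > 0" for i by (simp add: c_def)
    fix i j
    show "c i = c j \<longleftrightarrow> (\<exists>n. (p ^^ n) i = j)"
    proof
      assume "c i = c j"
      then have "Min (g ` cyc i) = Min (g ` cyc j)" by (simp add: c_def)
      moreover have "Min (g ` cyc i) \<in> g ` cyc i" "Min (g ` cyc j) \<in> g ` cyc j"
        by (auto intro!: Min_in simp: cyc_def)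
      ultimately obtain x where "x \<in> cyc i" "x \<in> cyc j"
        using injD[OF g] by (metis imageE)
      then obtain n m where "(p ^^ n) i = (p ^^ m) j"
        unfolding cyc_def by auto
      moreover obtain a where "(p ^^ a) ((p ^^ m) j) = j"
        using funpow_inj_return[OF assms] by blast
      ultimately have "(p ^^ (a + n)) i = j" by (simp add: funpow_add)
      then show "\<exists>n. (p ^^ n) i = j" by blast
    next
      assume "\<exists>n. (p ^^ n) i = j"
      then obtain n where n: "(p ^^ n) i = j" by blast
      moreover obtain a where "(p ^^ a) ((p ^^ n) i) = i"
        using funpow_inj_return[OF assms] by blast
      ultimately have "cyc i = cyc j" using sub[of n i] sub[of a j] by auto
      then show "c i = c j" by (simp add: c_def)
    qed
  qed
qed

text \<open>Breadth-first search from the inputs, with whole cycles of \<open>p\<close> as nodes,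
  builds the spanning forest. The vertices it misses would form a predecessor-closed set without
  inputs.\<close>

lemma structurally_controllable_if_reachable:
  fixes A :: "entry ^ 'd ^ 'd" and B :: "entry ^ 'm ^ 'd"
  assumes p: "inj p" "\<And>j. A $ (p j) $ j \<noteq> Zero"
    and reach: "\<And>U. U \<noteq> {} \<Longrightarrow> (\<And>i j. i \<in> U \<Longrightarrow> A $ i $ j \<noteq> Zero \<Longrightarrow> j \<in> U) \<Longrightarrow>
      \<exists>i\<in>U. \<exists>k. B $ i $ k \<noteq> Zero"
  shows "structurally_controllable A B"
proof -
  obtain c :: "'d \<Rightarrow> real" where c: "\<And>i. c i > 0" "\<And>i j. c i = c j \<longleftrightarrow> (\<exists>n. (p ^^ n) i = j)"
    using cycle_weights_exist[OF p(1)] by blast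
  \<comment> \<open>Membership is decided through \<open>c\<close>, so that a cycle enters a layer
    as a whole.\<close>
  define L where "L = rec_nat {i. \<exists>e k. c e = c i \<and> B $ e $ k \<noteq> Zero}
      (\<lambda>_ X. X \<union> {i. \<exists>e j. c e = c i \<and> j \<in> X \<and> A $ e $ j \<noteq> Zero})"
  have L0: "i \<in> L 0 \<longleftrightarrow> (\<exists>e k. c e = c i \<and> B $ e $ k \<noteq> Zero)"
    and LSuc: "i \<in> L (Suc n) \<longleftrightarrow> i \<in> L n \<or> (\<exists>e j. c e = c i \<and> j \<in> L n \<and> A $ e $ j \<noteq> Zero)" for i n
    by (simp_all add: L_def)
  have L_all: "\<exists>n. i \<in> L n" for i
  proof (rule ccontr)
    assume i: "\<nexists>n. i \<in> L n"
    let ?U = "{i. \<nexists>n. i \<in> L n}"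
    have "\<exists>i\<in>?U. \<exists>k. B $ i $ k \<noteq> Zero"
      by (rule reach) (use i LSuc in blast)+
    then show False using L0 by blast
  qed
  define rank where "rank = (\<lambda>i. LEAST n. i \<in> L n)"
  have rank_in: "i \<in> L (rank i)" for i
    unfolding rank_def using L_all by (metis LeastI)
  have rank_least: "rank i \<le> n" if "i \<in> L n" for i n
    unfolding rank_def using that by (rule Least_le)
  have L_cong: "i \<in> L n \<longleftrightarrow> j \<in> L n" if "c i = c j" for i j n
    by (induction n) (simp_all add: L0 LSuc that)
  have rank_cong: "rank i = rank j" if "c i = c j" for i j
    unfolding rank_def using L_cong[OF that] by simp
  have "\<exists>e. c e = c i \<and> (if rank i = 0 then \<exists>k. B $ e $ k \<noteq> Zero
      else \<exists>j. A $ e $ j \<noteq> Zero \<and> rank i = Suc (rank j))" for i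
  proof (cases "rank i")
    case 0
    then show ?thesis using rank_in[of i] L0[of i] by auto
  next
    case (Suc n)
    then have "i \<notin> L n" using rank_least[of i n] by auto
    then obtain e j where e: "c e = c i" "j \<in> L n" "A $ e $ j \<noteq> Zero"
      using rank_in[of i] Suc LSuc by auto
    \<comment> \<open>\<open>rank j\<close> is exactly \<open>n\<close>: a smaller value would put
      \<open>i\<close> into an earlier layer.\<close>
    have "i \<in> L (Suc (rank j))" using e rank_in[of j] LSuc by blast
    then have "rank i \<le> Suc (rank j)" by (rule rank_least)
    moreover have "rank j \<le> n" using e(2) by (rule rank_least)
    ultimately show ?thesis using e Suc by auto
  qed
  \<comment> \<open>Indexing by the weight instead of the vertex gives all vertices of a cycle the
    same entry vertex, as \<open>entry_unique\<close> demands.\<close>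
  then have "\<exists>e. c e = x \<and> (if rank e = 0 then \<exists>k. B $ e $ k \<noteq> Zero
      else \<exists>j. A $ e $ j \<noteq> Zero \<and> rank e = Suc (rank j))" if "x \<in> range c" for x
    using that rank_cong by (metis (no_types, lifting) imageE)
  then obtain f where f: "\<And>i. c (f (c i)) = c i"
    "\<And>i. if rank (f (c i)) = 0 then \<exists>k. B $ f (c i) $ k \<noteq> Zero
      else \<exists>j. A $ f (c i) $ j \<noteq> Zero \<and> rank (f (c i)) = Suc (rank j)"
    by (metis (no_types, lifting) rangeI)
  define E where "E = range (\<lambda>i. f (c i))"
  have fE: "if rank e = 0 then \<exists>k. B $ e $ k \<noteq> Zero
      else \<exists>j. A $ e $ j \<noteq> Zero \<and> rank e = Suc (rank j)" if e: "e \<in> E" for e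
  proof -
    obtain i where "e = f (c i)" using e unfolding E_def by blast
    then show ?thesis using f(2)[of i] by (simp only:)
  qed
  have "\<exists>k. rank e = 0 \<longrightarrow> B $ e $ k \<noteq> Zero" if "e \<in> E" for e
    using fE[OF that] by (cases "rank e = 0") simp_all
  then obtain inp where inp: "\<And>e. e \<in> E \<Longrightarrow> rank e = 0 \<Longrightarrow> B $ e $ inp e \<noteq> Zero"
    by metis
  have "\<exists>j. rank e > 0 \<longrightarrow> A $ e $ j \<noteq> Zero \<and> rank e = Suc (rank j)" if "e \<in> E" for e
    using fE[OF that] by (cases "rank e = 0") simp_all
  then obtain par where par: "\<And>e. e \<in> E \<Longrightarrow> rank e > 0 \<Longrightarrow> A $ e $ par e \<noteq> Zero"
    "\<And>e. e \<in> E \<Longrightarrow> rank e > 0 \<Longrightarrow> rank e = Suc (rank (par e))"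
    by metis
  interpret cycle_forest p c rank E par inp
  proof
    show "\<exists>e\<in>E. c e = c i" for i using f(1) unfolding E_def by blast
    show "e = e'" if "e \<in> E" "e' \<in> E" "c e = c e'" for e e'
      using that f(1) unfolding E_def by auto
  qed (use p c rank_cong par in auto)
  have "realization A state_matrix"
    unfolding realization_def state_matrix_def using p(2) par(1) by auto
  moreover have "realization B input_matrix"
    unfolding realization_def input_matrix_def using inp by auto
  ultimately show ?thesis
    unfolding structurally_controllable_def using controllable by blast
qed

lemma structurally_controllable_imp_sscc_input:
  assumes "structurally_controllable A B" "is_sscc (state_digraph A) S"
  shows "\<exists>i\<in>verts S. \<exists>k. B $ i $ k \<noteq> Zero"
proof -
  obtain A' B' where AB: "realization A A'" "realization B B'" "controllable A' B'"
    using assms(1) unfolding structurally_controllable_def by blast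
  have "A' $ i $ j = 0" if "i \<in> verts S" "j \<notin> verts S" for i j
    using sscc_predecessor[OF assms(2)] that AB(1) unfolding realization_def by blast
  then have "\<exists>i\<in>verts S. \<exists>k. B' $ i $ k \<noteq> 0"
    using controllable_imp_input_into_closed_set[OF AB(3) sscc_verts_nonempty[OF assms(2)]] by blast
  then show ?thesis using AB(2) unfolding realization_def by blast
qed

lemma structurally_controllable_iff_sscc_inputs:
  assumes "\<exists>M. perfect_matching UNIV (bipartite_edges A) M"
  shows "structurally_controllable A B \<longleftrightarrow>
    (\<forall>S. is_sscc (state_digraph A) S \<longrightarrow> (\<exists>i\<in>verts S. \<exists>k. B $ i $ k \<noteq> Zero))"
proof
  assume inputs: "\<forall>S. is_sscc (state_digraph A) S \<longrightarrow> (\<exists>i\<in>verts S. \<exists>k. B $ i $ k \<noteq> Zero)"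
  obtain p where p: "inj p" "\<And>j. A $ (p j) $ j \<noteq> Zero"
    using assms perfect_matching_imp_permutation by metis
  show "structurally_controllable A B"
  proof (rule structurally_controllable_if_reachable[OF p])
    fix U assume "U \<noteq> {}" "\<And>i j. i \<in> U \<Longrightarrow> A $ i $ j \<noteq> Zero \<Longrightarrow> j \<in> U"
    then obtain S where "is_sscc (state_digraph A) S" "verts S \<subseteq> U"
      using sscc_in_predecessor_closed_set[of U A] by blast
    then show "\<exists>i\<in>U. \<exists>k. B $ i $ k \<noteq> Zero" using inputs by blast
  qed
qed (use structurally_controllable_imp_sscc_input in auto)

section \<open>Optimality of the selection\<close>

text \<open>Components are disjoint, so the row of the chosen entry determines the component. This
  serves both the selection and an arbitrary competitor.\<close>

lemma inj_on_sscc_choice: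
  assumes "\<And>S. is_sscc (state_digraph A) S \<Longrightarrow> fst (f S) \<in> verts S"
  shows "inj_on f {S. is_sscc (state_digraph A) S}"
proof (rule inj_onI)
  fix S S' assume "S \<in> {S. is_sscc (state_digraph A) S}" "S' \<in> {S. is_sscc (state_digraph A) S}" "f S = f S'"
  then show "S = S'"
    using assms[of S] assms[of S'] sccs_eq_if_common_vertex[of S A S' "fst (f S)"]
    by (simp add: is_sscc_def)
qed

text \<open>Minimality over \<open>V\<close> and then within row \<open>i\<close> bounds the
  selected extended cost by that of \<open>(i, j)\<close>. The latter is finite, so the selected
  entry is not a zero of \<open>B\<close>.\<close>

lemma selects_optimal:
  assumes "selects (ext_cost B w) V (k, l)" "i \<in> V" "B $ i $ j \<noteq> Zero"
  shows "l \<in> V" "B $ l $ k \<noteq> Zero" "w $ l $ k \<le> w $ i $ j"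
proof -
  obtain h where h: "\<And>x. x \<in> V \<Longrightarrow> is_arg_min (ext_cost B w x) (\<lambda>_. True) (h x)"
    "is_arg_min (\<lambda>x. ext_cost B w x (h x)) (\<lambda>x. x \<in> V) l" "k = h l"
    using assms(1) unfolding selects_def by auto
  then show "l \<in> V" by (simp add: is_arg_min_def)
  have "ext_cost B w l k \<le> ext_cost B w i (h i)"
    using h(2,3) assms(2) unfolding is_arg_min_def by (metis not_less)
  also have "\<dots> \<le> ext_cost B w i j"
    using h(1)[OF assms(2)] unfolding is_arg_min_def by (metis not_less)
  finally have "ext_cost B w l k \<le> ereal (w $ i $ j)"
    using assms(3) by (simp add: ext_cost_def)
  then show "B $ l $ k \<noteq> Zero" "w $ l $ k \<le> w $ i $ j"
    by (auto simp: ext_cost_def split: if_splits)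
qed

theorem theorem4p3:
  fixes A :: "entry ^ 'd ^ 'd" and B Bs :: "entry ^ 'm ^ 'd" and w :: "real ^ 'm ^ 'd"
  assumes "structurally_controllable A B"
    and "\<And>i j. B $ i $ j \<noteq> Zero \<Longrightarrow> w $ i $ j \<ge> 0"
    and "\<exists>M. perfect_matching UNIV (bipartite_edges A) M"
    and "sscc_selection_output A B w Bs"
  shows "structurally_controllable A Bs \<and>
    is_arg_min (norm_w w) (\<lambda>B'. B' \<in> K_set A B \<and> (\<forall>B''\<in>K_set A B. norm0 B' \<le> norm0 B'')) Bs"
proof -
  define Q where "Q = {S. is_sscc (state_digraph A) S}"
  have "finite Q" unfolding Q_def by (rule finite_ssccs)
  obtain sel where sel: "\<And>S. S \<in> Q \<Longrightarrow> selects (ext_cost B w) (verts S) (sel S)"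
    and Bs: "Bs = (\<chi> l k. if (k, l) \<in> sel ` Q then Star else Zero)"
    using assms(4) unfolding sscc_selection_output_def Let_def Q_def by auto
  \<comment> \<open>\<open>L\<close> holds pairs (input, state), whereas matrices are indexed by
    (state, input).\<close>
  define g where "g = prod.swap \<circ> sel"
  have g_eq: "g S = (i, k) \<longleftrightarrow> sel S = (k, i)" for S i k
    by (cases "sel S") (auto simp: g_def)
  have nz_Bs: "{(i, k). Bs $ i $ k \<noteq> Zero} = g ` Q"
  proof -
    have "(k, i) \<in> sel ` Q \<longleftrightarrow> (i, k) \<in> g ` Q" for i k
      unfolding image_iff using g_eq by metis
    then show ?thesis by (auto simp: Bs)
  qed
  have input: "\<exists>i\<in>verts S. \<exists>k. B' $ i $ k \<noteq> Zero" if "structurally_controllable A B'" "S \<in> Q" for S B'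
    using structurally_controllable_imp_sscc_input that by (auto simp: Q_def)
  have g: "l \<in> verts S" "B $ l $ k \<noteq> Zero"
    "\<And>i j. i \<in> verts S \<Longrightarrow> B $ i $ j \<noteq> Zero \<Longrightarrow> w $ l $ k \<le> w $ i $ j"
    if S: "S \<in> Q" and gS: "g S = (l, k)" for S l k
  proof -
    have s: "selects (ext_cost B w) (verts S) (k, l)"
      using sel[OF S] gS g_eq by simp
    \<comment> \<open>Structural controllability of \<open>(A, B)\<close> supplies an entry of
      finite cost in the component.\<close>
    obtain i j where "i \<in> verts S" "B $ i $ j \<noteq> Zero" using input[OF assms(1) S] by blast
    then show "l \<in> verts S" "B $ l $ k \<noteq> Zero" using selects_optimal[OF s] by blast+
    show "w $ l $ k \<le> w $ i $ j" if "i \<in> verts S" "B $ i $ j \<noteq> Zero" for i j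
      using selects_optimal[OF s that] by blast
  qed
  have inj_g: "inj_on g Q"
    unfolding Q_def by (rule inj_on_sscc_choice) (use g(1) Q_def in \<open>metis mem_Collect_eq prod.collapse\<close>)
  have Bs_ctrl: "structurally_controllable A Bs"
    unfolding structurally_controllable_iff_sscc_inputs[OF assms(3)]
  proof (intro allI impI)
    fix S assume "is_sscc (state_digraph A) S"
    then have S: "S \<in> Q" by (simp add: Q_def)
    obtain l k where lk: "g S = (l, k)" by fastforce
    then have "(l, k) \<in> {(i, k). Bs $ i $ k \<noteq> Zero}" unfolding nz_Bs using S by force
    then show "\<exists>i\<in>verts S. \<exists>k. Bs $ i $ k \<noteq> Zero" using g(1)[OF S lk] by auto
  qed
  have "zero_set B \<subseteq> zero_set Bs"
  proof -
    have "B $ l $ k \<noteq> Zero" if "Bs $ l $ k \<noteq> Zero" for l k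
    proof -
      have "(l, k) \<in> g ` Q" using that unfolding nz_Bs[symmetric] by simp
      then show ?thesis using g(2) by force
    qed
    then show ?thesis unfolding zero_set_def by blast
  qed
  with Bs_ctrl have Bs_K: "Bs \<in> K_set A B" by (simp add: K_set_def)
  have norm0_Bs: "norm0 Bs = card Q"
    unfolding norm0_def nz_Bs by (rule card_image[OF inj_g])
  have norm_w_Bs: "norm_w w Bs = (\<Sum>S\<in>Q. case g S of (i, k) \<Rightarrow> w $ i $ k)"
    unfolding norm_w_def nz_Bs by (simp add: sum.reindex[OF inj_g])
  \<comment> \<open>A competitor has an entry in every source component; one such choice
    \<open>f\<close> is compared with \<open>g\<close> componentwise.\<close>
  have lower: "card Q \<le> norm0 B' \<and> norm_w w Bs \<le> norm_w w B'" if "B' \<in> K_set A B" for B'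
  proof -
    have B': "structurally_controllable A B'" "\<And>i k. B' $ i $ k \<noteq> Zero \<Longrightarrow> B $ i $ k \<noteq> Zero"
      using that by (auto simp: K_set_def zero_set_def)
    have "\<exists>e. fst e \<in> verts S \<and> B' $ fst e $ snd e \<noteq> Zero" if "S \<in> Q" for S
      using input[OF B'(1) that] by auto
    then obtain f where f: "\<And>S. S \<in> Q \<Longrightarrow> fst (f S) \<in> verts S \<and> B' $ fst (f S) $ snd (f S) \<noteq> Zero"
      by metis
    have inj_f: "inj_on f Q"
      unfolding Q_def by (rule inj_on_sscc_choice) (use f Q_def in blast)
    have image_f: "f ` Q \<subseteq> {(i, k). B' $ i $ k \<noteq> Zero}" using f by (auto simp: case_prod_unfold)
    then have "card Q \<le> norm0 B'"
      unfolding norm0_def by (metis card_image card_mono finite inj_f)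
    moreover have "norm_w w Bs \<le> (\<Sum>S\<in>Q. case f S of (i, k) \<Rightarrow> w $ i $ k)"
      unfolding norm_w_Bs
    proof (rule sum_mono)
      fix S assume S: "S \<in> Q"
      obtain l k i j where lk: "g S = (l, k)" "f S = (i, j)" by fastforce
      then show "(case g S of (i, k) \<Rightarrow> w $ i $ k) \<le> (case f S of (i, k) \<Rightarrow> w $ i $ k)"
        using g(3)[OF S lk(1), of i j] f[OF S] B'(2) by simp
    qed
    moreover have "\<dots> = (\<Sum>(i, k)\<in>f ` Q. w $ i $ k)"
      by (simp add: sum.reindex[OF inj_f])
    \<comment> \<open>The entries of \<open>B'\<close> outside the choice have nonnegative
      costs.\<close>
    moreover have "\<dots> \<le> norm_w w B'"
      unfolding norm_w_def by (rule sum_mono2) (use image_f B'(2) assms(2) in auto)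
    ultimately show ?thesis by linarith
  qed
  have "is_arg_min (norm_w w) (\<lambda>B'. B' \<in> K_set A B \<and> (\<forall>B''\<in>K_set A B. norm0 B' \<le> norm0 B'')) Bs"
    unfolding is_arg_min_def using Bs_K lower norm0_Bs by (auto simp: not_less)
  with Bs_ctrl show ?thesis by blast
qed

end
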